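(* Let $m$ be an odd number with even root $2^u \cdot b$, where $b$ is an odd number and $u > 2$. Then after one reduced Collatz iteration the multiplicative factor of the root decreases by a factor of $3 \cdot 2^{-2}$ (that is, the multiplicative factor of the root of $R(m)$ is $3 \cdot 2^{-2}$ times the multiplicative factor of the root of $m$), but the root remains even.
   Context: Numbers are positive integers. For an odd number $m$, the root of $m$ is the integer $a \ge 0$ with $m = 2a+1$. The reduced Collatz iteration sends an odd number $m$ to $R(m) = \frac{3m+1}{2^x}$, where $2^x$ is the highest power of $2$ dividing $3m+1$. When an even root is written as $2^y \cdot 3^v \cdot c$ with $v \ge 0$ and $c$ odd and not a multiple of $3$, the factor $2^y \cdot 3^v$ is called the multiplicative factor of the root. *)

theory Defs
  imports Complex_Main "HOL-Computational_Algebra.Primes"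
begin

text \<open>Intended for odd \<open>m\<close>; unspecified for even \<open>m\<close>.\<close>

definition collatz_root :: "nat \<Rightarrow> nat" where
  "collatz_root m = (THE a. m = 2 * a + 1)"

definition reduced_collatz :: "nat \<Rightarrow> nat" where
  "reduced_collatz m = (3 * m + 1) div 2 ^ multiplicity 2 (3 * m + 1)"

text \<open>Well-defined for every \<open>a > 0\<close> (lemma \<open>mult_factor_eqI\<close> and lemma
  \<open>mult_factor_decomp\<close>); unspecified for \<open>a = 0\<close>.\<close>

definition mult_factor :: "nat \<Rightarrow> nat" where
  "mult_factor a =
    (THE f. \<exists>y v c. a = 2 ^ y * 3 ^ v * c \<and> odd c \<and> \<not> 3 dvd c \<and> f = 2 ^ y * 3 ^ v)"

lemma collatz_root_eq [simp]: "collatz_root (2 * a + 1) = a"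
  unfolding collatz_root_def by (rule the_equality) auto

lemma mult_factor_decomp_unique:
  fixes c c' :: nat
  assumes eq: "2 ^ y * 3 ^ v * c = 2 ^ y' * 3 ^ v' * c'"
    and c: "odd c" "\<not> 3 dvd c" and c': "odd c'" "\<not> 3 dvd c'"
  shows "y = y'" "v = v'" "c = c'"
proof -
  have p3: "prime (3::nat)" by simp
  have two: "multiplicity 2 (2 ^ i * 3 ^ j * d) = i" if "odd d" for i j d :: nat
    using that by (intro multiplicity_eqI) (auto simp: mult.assoc)
  have three: "multiplicity 3 (2 ^ i * 3 ^ j * d) = j" if "\<not> 3 dvd d" for i j d :: nat
  proof (rule multiplicity_eqI)
    have "\<not> (3::nat) dvd 2 ^ i"
      using prime_dvd_power[OF p3, of 2 i] by auto
    then have "\<not> 3 dvd 2 ^ i * d"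
      using that p3 by (simp add: prime_dvd_mult_iff)
    then show "\<not> 3 ^ Suc j dvd 2 ^ i * 3 ^ j * d"
      by (simp add: ac_simps)
  qed auto
  show y: "y = y'" using two[OF c(1), of y v] two[OF c'(1), of y' v'] eq by simp
  show v: "v = v'" using three[OF c(2), of y v] three[OF c'(2), of y' v'] eq by simp
  show "c = c'" using eq y v by simp
qed

lemma mult_factor_eqI:
  assumes "a = 2 ^ y * 3 ^ v * c" "odd c" "\<not> 3 dvd c"
  shows "mult_factor a = 2 ^ y * 3 ^ v"
  unfolding mult_factor_def
proof (rule the_equality)
  fix f
  assume "\<exists>y v c. a = 2 ^ y * 3 ^ v * c \<and> odd c \<and> \<not> 3 dvd c \<and> f = 2 ^ y * 3 ^ v"
  then show "f = 2 ^ y * 3 ^ v"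
    using mult_factor_decomp_unique assms by metis
qed (use assms in blast)

lemma mult_factor_decomp:
  fixes a :: nat
  assumes "a > 0"
  shows "\<exists>y v c. a = 2 ^ y * 3 ^ v * c \<and> odd c \<and> \<not> 3 dvd c"
proof -
  obtain d where d: "a = 2 ^ multiplicity 2 a * d" "odd d"
    by (rule multiplicity_decompose'[of a 2]) (use assms in auto)
  have "d \<noteq> 0" using d(2) by (cases "d = 0") auto
  obtain c where c: "d = 3 ^ multiplicity 3 d * c" "\<not> 3 dvd c"
    by (rule multiplicity_decompose'[of d 3]) (use \<open>d \<noteq> 0\<close> in auto)
  have "odd c" using c d(2) by (metis dvd_mult)
  then show ?thesis using c d by (metis mult.assoc)
qed

end

theory Submission
  imports Defs
begin

text \<open>If \<open>m\<close> has root \<open>a = 2 ^ u * b\<close>, then 3m + 1 = 6a + 4 = 4(3a/2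
  + 1). As 4 divides \<open>a\<close>, the bracket is odd, so it is R(m), and its root is 3a/4
  (\<open>reduced_collatz_root\<close>). This is even because u - 2 > 0. Passing from
  \<open>a\<close> to 3a/4 keeps the part coprime to 6, so by \<open>mult_factor_eqI\<close> the
  multiplicative factor is itself scaled by 3/4.\<close>

lemma reduced_collatz_root:
  "reduced_collatz (2 * (2 ^ (k + 3) * b) + 1) = 2 * (2 ^ (k + 1) * 3 * b) + 1"
proof -
  let ?r = "2 * (2 ^ (k + 1) * 3 * b) + 1 :: nat"
  have eq: "3 * (2 * (2 ^ (k + 3) * b) + 1) + 1 = 2 ^ 2 * ?r"
    by (simp add: power_add)
  \<comment> \<open>\<open>?r\<close> is odd, so 8 does not divide
    \<open>2 ^ 2 * ?r\<close>.\<close>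
  have "multiplicity 2 (2 ^ 2 * ?r) = 2"
    by (rule multiplicity_eqI) (auto, presburger)
  then show ?thesis
    unfolding reduced_collatz_def eq by simp
qed

theorem theorem5:
  fixes m u b :: nat
  assumes "odd m"
    and "collatz_root m = 2 ^ u * b"
    and "odd b"
    and "u > 2"
  shows "real (mult_factor (collatz_root (reduced_collatz m)))
           = 3 * 2 powi (-2) * real (mult_factor (collatz_root m))
         \<and> even (collatz_root (reduced_collatz m))"
proof -
  \<comment> \<open>This avoids subtraction on naturals: the new exponent u - 2 becomes
    \<open>k + 1\<close>, visibly positive.\<close>
  obtain k where u: "u = k + 3"
    using \<open>u > 2\<close> by (metis add.commute less_eq_Suc_le less_eqE numeral_3_eq_3 numeral_2_eq_2)
  have m: "m = 2 * (2 ^ (k + 3) * b) + 1"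
    using assms(1,2) u by (metis collatz_root_eq oddE)
  have root: "collatz_root (reduced_collatz m) = 2 ^ (k + 1) * 3 * b"
    unfolding m reduced_collatz_root by (rule collatz_root_eq)
  \<comment> \<open>\<open>b\<close> may still contain powers of 3, which belong to the factor. The
    same cofactor \<open>c\<close> then serves both roots.\<close>
  have "b > 0"
    using \<open>odd b\<close> by (rule odd_pos)
  then obtain y v c where b: "b = 2 ^ y * 3 ^ v * c" and c: "odd c" "\<not> 3 dvd c"
    using mult_factor_decomp by blast
  have "mult_factor (collatz_root m) = 2 ^ (k + 3 + y) * 3 ^ v"
    by (rule mult_factor_eqI[OF _ c]) (simp add: assms(2) u b power_add)
  moreover have "mult_factor (collatz_root (reduced_collatz m)) = 2 ^ (k + 1 + y) * 3 ^ Suc v"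
    by (rule mult_factor_eqI[OF _ c]) (simp add: root b power_add)
  ultimately show ?thesis
    by (simp add: root power_add power_int_minus)
qed

end
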